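(* Let $X$ be a set. For every binary relation $R$ on $\mathfrak{M}(X)$, $\langle R\rangle=(R^c)^e$.
   Context: Free operated monoid: for a set $Y$, $M(Y)$ is the free monoid on $Y$, with identity $1$. For a set $X$ put $\mathfrak{M}_0(X)=M(X)$ and $\mathfrak{M}_{n+1}(X)=M(X\cup\lfloor \mathfrak{M}_n(X)\rfloor)$, where $\lfloor \mathfrak{M}_n(X)\rfloor=\{\lfloor u\rfloor\mid u\in \mathfrak{M}_n(X)\}$ is a disjoint copy of $\mathfrak{M}_n(X)$; via the natural embeddings $\mathfrak{M}_n(X)\hookrightarrow\mathfrak{M}_{n+1}(X)$ let $\mathfrak{M}(X)=\bigcup_{n\ge 0}\mathfrak{M}_n(X)$. Its elements are called bracketed words on $X$. It is a monoid equipped with the operator $w\mapsto\lfloor w\rfloor$, and it is the free operated monoid on $X$ (an operated monoid is a monoid together with a map from it to itself). $\star$-bracketed words: for a symbol $\star\notin X$, $\mathfrak{M}^\star(X)$ is the set of bracketed words on $X\cup\{\star\}$ with exactly one occurrence of $\star$; $q|_u$ is obtained from $q\in\mathfrak{M}^\star(X)$ by replacing $\star$ by $u$. Operated congruence: an equivalence relation $R$ on $\mathfrak{M}(X)$ such that $(a,b)\in R$ implies $(ac,bc)\in R$, $(ca,cb)\in R$ and $(\lfloor a\rfloor,\lfloor b\rfloor)\in R$ for all $a,b,c\in\mathfrak{M}(X)$. For a binary relation $R$ on $\mathfrak{M}(X)$, $\langle R\rangle$ is the smallest operated congruence containing $R$, and $R^c=\{(q|_a,q|_b)\mid q\in\mathfrak{M}^\star(X),\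 (a,b)\in R\}$. For a binary relation $T$ on a set, $T^e$ denotes the equivalence relation generated by $T$ (the smallest equivalence relation containing $T$). *)

theory Defs
  imports Main
begin

text \<open>
  The free monoid on a set \<open>Y\<close> is \<^term>\<open>lists Y\<close>, with concatenation as product and the empty
  list as identity. A letter of a bracketed word is either a generator or a bracketed word
  enclosed in brackets; the constructor \<open>Bracket\<close> provides the disjoint copies, and
  the embeddings of each level into the next are inclusions.
\<close>

datatype 'a letter = Gen 'a | Bracket "'a letter list"

type_synonym 'a bword = "'a letter list"

definition bracket :: "'a bword \<Rightarrow> 'a bword" where
  "bracket w = [Bracket w]"

primrec bwords_level :: "nat \<Rightarrow> 'a set \<Rightarrow> 'a bword set" where
  "bwords_level 0 X = lists (Gen ` X)"
| "bwords_level (Suc n) X = lists (Gen ` X \<union> Bracket ` bwords_level n X)"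

definition bwords :: "'a set \<Rightarrow> 'a bword set" where
  "bwords X = (\<Union>n. bwords_level n X)"

text \<open>
  The alphabet \<open>X \<union> {\<star>}\<close> is rendered in the type \<^typ>\<open>'a option\<close>, with \<^term>\<open>None\<close> as \<open>\<star>\<close>
  and \<^term>\<open>Some x\<close> as the element \<open>x\<close> of \<open>X\<close>; thus \<open>\<star> \<notin> X\<close> holds by construction.
\<close>

primrec star_count_letter :: "'a option letter \<Rightarrow> nat" where
  "star_count_letter (Gen x) = (if x = None then 1 else 0)"
| "star_count_letter (Bracket w) = sum_list (map star_count_letter w)"

definition star_count :: "'a option bword \<Rightarrow> nat" where
  "star_count w = sum_list (map star_count_letter w)"

definition star_bwords :: "'a set \<Rightarrow> 'a option bword set" where
  "star_bwords X = {q \<in> bwords (insert None (Some ` X)). star_count q = 1}"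

primrec star_subst_letter :: "'a bword \<Rightarrow> 'a option letter \<Rightarrow> 'a bword" where
  "star_subst_letter u (Gen x) = (case x of None \<Rightarrow> u | Some y \<Rightarrow> [Gen y])"
| "star_subst_letter u (Bracket w) = bracket (concat (map (star_subst_letter u) w))"

definition star_subst :: "'a option bword \<Rightarrow> 'a bword \<Rightarrow> 'a bword" where
  "star_subst q u = concat (map (star_subst_letter u) q)"

definition operated_congruence :: "'a set \<Rightarrow> 'a bword rel \<Rightarrow> bool" where
  "operated_congruence X R \<longleftrightarrow> equiv (bwords X) R \<and>
     (\<forall>a\<in>bwords X. \<forall>b\<in>bwords X. \<forall>c\<in>bwords X. (a, b) \<in> R \<longrightarrow>
        (a @ c, b @ c) \<in> R \<and> (c @ a, c @ b) \<in> R \<and> (bracket a, bracket b) \<in> R)"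

definition op_cong_gen :: "'a set \<Rightarrow> 'a bword rel \<Rightarrow> 'a bword rel" where
  "op_cong_gen X R = \<Inter>{S. operated_congruence X S \<and> R \<subseteq> S}"

definition star_closure :: "'a set \<Rightarrow> 'a bword rel \<Rightarrow> 'a bword rel" where
  "star_closure X R = {(star_subst q a, star_subst q b) | q a b. q \<in> star_bwords X \<and> (a, b) \<in> R}"

definition equiv_gen :: "'b set \<Rightarrow> 'b rel \<Rightarrow> 'b rel" where
  "equiv_gen A T = \<Inter>{E. equiv A E \<and> T \<subseteq> E}"

lemma bwords_level_mono_Suc: "bwords_level n X \<subseteq> bwords_level (Suc n) X"
proof (induction n)
  case (Suc n)
  then have "Gen ` X \<union> Bracket ` bwords_level n X \<subseteq> Gen ` X \<union> Bracket ` bwords_level (Suc n) X"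
    by blast
  then show ?case
    by (metis bwords_level.simps(2) lists_mono)
qed (auto intro: lists_mono)

lemma bwords_level_mono: "m \<le> n \<Longrightarrow> bwords_level m X \<subseteq> bwords_level n X"
  using lift_Suc_mono_le[of "\<lambda>n. bwords_level n X"] bwords_level_mono_Suc[of _ X] by blast

lemma append_level: "u \<in> bwords_level n X \<Longrightarrow> v \<in> bwords_level n X \<Longrightarrow> u @ v \<in> bwords_level n X"
  by (cases n) (auto simp: in_lists_conv_set)

lemma Nil_in_bwords: "[] \<in> bwords X"
  unfolding bwords_def by (rule UN_I[of 0]) auto

lemma append_in_bwords:
  assumes "u \<in> bwords X" "v \<in> bwords X"
  shows "u @ v \<in> bwords X"
proof -
  obtain m n where "u \<in> bwords_level m X" "v \<in> bwords_level n X"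
    using assms unfolding bwords_def by blast
  then have "u \<in> bwords_level (max m n) X" "v \<in> bwords_level (max m n) X"
    using bwords_level_mono[of m "max m n" X] bwords_level_mono[of n "max m n" X] by auto
  then show ?thesis
    unfolding bwords_def using append_level by blast
qed

lemma bracket_in_bwords:
  assumes "u \<in> bwords X"
  shows "bracket u \<in> bwords X"
proof -
  obtain n where "u \<in> bwords_level n X"
    using assms unfolding bwords_def by blast
  then have "bracket u \<in> bwords_level (Suc n) X"
    by (auto simp: bracket_def)
  then show ?thesis
    unfolding bwords_def by blast
qed

lemma Gen_in_bwords: "x \<in> X \<Longrightarrow> [Gen x] \<in> bwords X"
  unfolding bwords_def by (rule UN_I[of 0]) auto

lemma concat_in_bwords: "(\<And>w. w \<in> set ws \<Longrightarrow> w \<in> bwords X) \<Longrightarrow> concat ws \<in> bwords X"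
  by (induction ws) (auto intro: Nil_in_bwords append_in_bwords)

lemma star_subst_level:
  assumes "u \<in> bwords X"
  shows "q \<in> bwords_level n (insert None (Some ` X)) \<Longrightarrow> star_subst q u \<in> bwords X"
proof (induction n arbitrary: q)
  case 0
  have "star_subst_letter u l \<in> bwords X" if "l \<in> set q" for l
  proof -
    from that 0 consider "l = Gen None" | x where "l = Gen (Some x)" "x \<in> X"
      by (auto simp: in_lists_conv_set)
    then show ?thesis
      by cases (use assms in \<open>auto intro: Gen_in_bwords\<close>)
  qed
  then show ?case
    unfolding star_subst_def by (intro concat_in_bwords) auto
next
  case (Suc n)
  have "star_subst_letter u l \<in> bwords X" if "l \<in> set q" for l
  proof -
    from that Suc.prems consider "l = Gen None" | x where "l = Gen (Some x)" "x \<in> X"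
      | w where "l = Bracket w" "w \<in> bwords_level n (insert None (Some ` X))"
      by (auto simp: in_lists_conv_set)
    then show ?thesis
      by cases (use assms Suc.IH in \<open>auto simp: star_subst_def intro: Gen_in_bwords bracket_in_bwords\<close>)
  qed
  then show ?case
    unfolding star_subst_def by (intro concat_in_bwords) auto
qed

lemma star_closure_subset:
  assumes "R \<subseteq> bwords X \<times> bwords X"
  shows "star_closure X R \<subseteq> bwords X \<times> bwords X"
  using assms star_subst_level[where X = X]
  unfolding star_closure_def star_bwords_def bwords_def[of "insert None (Some ` X)"]
  by blast

text \<open>
  The intersections above are the smallest relations of their kind as soon as the generating
  relation lives on the carrier.
\<close>

lemma equiv_gen_least:
  assumes "T \<subseteq> A \<times> A"
  shows "equiv A (equiv_gen A T)" "T \<subseteq> equiv_gen A T"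
    and "equiv A E \<Longrightarrow> T \<subseteq> E \<Longrightarrow> equiv_gen A T \<subseteq> E"
proof -
  have "equiv A (A \<times> A)"
    by (auto simp: equiv_def refl_on_def sym_def trans_def)
  with assms have "equiv_gen A T \<subseteq> A \<times> A"
    unfolding equiv_gen_def by blast
  moreover have "refl_on A (equiv_gen A T)"
    by (auto simp: equiv_gen_def equiv_def refl_on_def)
  moreover have "sym (equiv_gen A T)"
    by (auto simp: equiv_gen_def equiv_def intro!: symI dest: symD)
  moreover have "trans (equiv_gen A T)"
    by (rule transI) (auto simp: equiv_gen_def equiv_def dest: transD)
  ultimately show "equiv A (equiv_gen A T)"
    by (simp add: equiv_def)
qed (auto simp: equiv_gen_def)

lemma op_cong_gen_least:
  assumes "R \<subseteq> bwords X \<times> bwords X"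
  shows "operated_congruence X (op_cong_gen X R)" "R \<subseteq> op_cong_gen X R"
    and "operated_congruence X S \<Longrightarrow> R \<subseteq> S \<Longrightarrow> op_cong_gen X R \<subseteq> S"
proof -
  have "operated_congruence X (bwords X \<times> bwords X)"
    by (auto simp: operated_congruence_def equiv_def refl_on_def sym_def trans_def
        intro: append_in_bwords bracket_in_bwords)
  with assms have "op_cong_gen X R \<subseteq> bwords X \<times> bwords X"
    unfolding op_cong_gen_def by blast
  moreover have "refl_on (bwords X) (op_cong_gen X R)"
    by (auto simp: op_cong_gen_def operated_congruence_def equiv_def refl_on_def)
  moreover have "sym (op_cong_gen X R)"
    by (auto simp: op_cong_gen_def operated_congruence_def equiv_def intro!: symI dest: symD)
  moreover have "trans (op_cong_gen X R)"
    by (rule transI) (auto simp: op_cong_gen_def operated_congruence_def equiv_def dest: transD)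
  ultimately have "equiv (bwords X) (op_cong_gen X R)"
    by (simp add: equiv_def)
  moreover have "(a @ c, b @ c) \<in> op_cong_gen X R \<and> (c @ a, c @ b) \<in> op_cong_gen X R \<and>
      (bracket a, bracket b) \<in> op_cong_gen X R"
    if "a \<in> bwords X" "b \<in> bwords X" "c \<in> bwords X" "(a, b) \<in> op_cong_gen X R" for a b c
    using that by (auto simp: op_cong_gen_def operated_congruence_def)
  ultimately show "operated_congruence X (op_cong_gen X R)"
    unfolding operated_congruence_def by simp
qed (auto simp: op_cong_gen_def)

end

theory Submission
  imports Defs
begin

text \<open>
  The context closure is already stable under multiplication on either side and under brackets, and
  a map that preserves a relation also preserves the equivalence relation it generates. Conversely,
  by induction on the context \<open>q\<close>, an operated congruence relates \<open>q|\<^sub>a\<close> and \<open>q|\<^sub>b\<close> whenever it relates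
  \<open>a\<close> and \<open>b\<close>; for this the number of occurrences of \<open>\<star>\<close> in \<open>q\<close> is irrelevant.
\<close>

text \<open>Two nested inductions hide the levels from later proofs: the outer one, on nesting
  depth, handles the content of a bracket, and the inner one runs along the letters of the
  word.\<close>

lemma bwords_induct [consumes 1, case_names Nil Gen Bracket]:
  assumes "w \<in> bwords X"
    and Nil: "P []"
    and Gen: "\<And>x w. x \<in> X \<Longrightarrow> w \<in> bwords X \<Longrightarrow> P w \<Longrightarrow> P (Gen x # w)"
    and Bracket: "\<And>u w. u \<in> bwords X \<Longrightarrow> P u \<Longrightarrow> w \<in> bwords X \<Longrightarrow> P w \<Longrightarrow> P (Bracket u # w)"
  shows "P w"
proof -
  have level: "bwords_level n X \<subseteq> bwords X" for n
    unfolding bwords_def by blast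
  have "P w" if "w \<in> bwords_level n X" for n w
    using that
  proof (induction n arbitrary: w)
    case 0
    then have "w \<in> lists (Gen ` X)"
      by simp
    then show ?case
      by (induction w) (use level[of 0] in \<open>auto intro: Nil Gen\<close>)
  next
    case (Suc n)
    from Suc.prems have "w \<in> lists (Gen ` X \<union> Bracket ` bwords_level n X)"
      by simp
    then show ?case
    proof (induction w)
      case (Cons l w)
      then have "w \<in> bwords X"
        using level[of "Suc n"] by auto
      \<comment> \<open>If \<open>l\<close> is \<open>Bracket u\<close>, then \<open>u\<close> lies
        at level \<open>n\<close> and the outer hypothesis gives \<open>P u\<close>; the inner
        hypothesis gives \<open>P w\<close> for the tail.\<close>
      with Cons Suc.IH level[of n] show ?case
        by (auto intro: Gen Bracket)
    qed (rule Nil)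
  qed
  with \<open>w \<in> bwords X\<close> show ?thesis
    unfolding bwords_def by blast
qed

lemma Gen_Cons_in_bwords: "x \<in> X \<Longrightarrow> w \<in> bwords X \<Longrightarrow> Gen x # w \<in> bwords X"
  using append_in_bwords[OF Gen_in_bwords, of x X w] by simp

lemma Bracket_Cons_in_bwords: "u \<in> bwords X \<Longrightarrow> w \<in> bwords X \<Longrightarrow> Bracket u # w \<in> bwords X"
  using append_in_bwords[OF bracket_in_bwords, of u X w] by (simp add: bracket_def)

lemma star_subst_simps:
  "star_subst [] u = []"
  "star_subst (Gen None # q) u = u @ star_subst q u"
  "star_subst (Gen (Some x) # q) u = Gen x # star_subst q u"
  "star_subst (Bracket p # q) u = bracket (star_subst p u) @ star_subst q u"
  "star_subst (p @ q) u = star_subst p u @ star_subst q u"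
  by (simp_all add: star_subst_def)

lemma star_count_simps:
  "star_count [] = 0"
  "star_count (Gen None # q) = Suc (star_count q)"
  "star_count (Gen (Some x) # q) = star_count q"
  "star_count (Bracket p # q) = star_count p + star_count q"
  "star_count (p @ q) = star_count p + star_count q"
  by (simp_all add: star_count_def)

text \<open>Renaming each generator \<open>x\<close> of \<open>c\<close> to \<open>Some x\<close>
  gives a word without a star, so every substitution simply undoes the renaming. Such copies let a
  factor \<open>c\<close> be absorbed into a context.\<close>

lemma star_free_bword:
  assumes "c \<in> bwords X"
  obtains q where "q \<in> bwords (insert None (Some ` X))" "star_count q = 0" "\<And>u. star_subst q u = c"
proof -
  have "\<exists>q \<in> bwords (insert None (Some ` X)). star_count q = 0 \<and> (\<forall>u. star_subst q u = c)"
    using assms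
  proof (induction rule: bwords_induct)
    case Nil
    show ?case
      by (rule bexI[of _ "[]"]) (auto simp: star_subst_simps star_count_simps Nil_in_bwords)
  next
    case (Gen x w)
    then obtain q where q: "q \<in> bwords (insert None (Some ` X))" "star_count q = 0"
      "\<forall>u. star_subst q u = w" by blast
    then show ?case
      using \<open>x \<in> X\<close> by (intro bexI[of _ "Gen (Some x) # q"])
        (auto simp: star_subst_simps star_count_simps intro: Gen_Cons_in_bwords)
  next
    case (Bracket v w)
    then obtain p q where "p \<in> bwords (insert None (Some ` X))" "star_count p = 0"
      "\<forall>u. star_subst p u = v" "q \<in> bwords (insert None (Some ` X))" "star_count q = 0"
      "\<forall>u. star_subst q u = w" by blast
    then show ?case
      by (intro bexI[of _ "Bracket p # q"])
        (auto simp: star_subst_simps star_count_simps bracket_def intro: Bracket_Cons_in_bwords)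
  qed
  with that show ?thesis
    by blast
qed

lemma operated_congruenceD:
  assumes "operated_congruence X S"
  shows "equiv (bwords X) S"
    and "(a, b) \<in> S \<Longrightarrow> c \<in> bwords X \<Longrightarrow> (a @ c, b @ c) \<in> S"
    and "(a, b) \<in> S \<Longrightarrow> c \<in> bwords X \<Longrightarrow> (c @ a, c @ b) \<in> S"
    and "(a, b) \<in> S \<Longrightarrow> (bracket a, bracket b) \<in> S"
    and "(a, b) \<in> S \<Longrightarrow> a \<in> bwords X \<and> b \<in> bwords X"
proof -
  show "equiv (bwords X) S"
    using assms by (simp add: operated_congruence_def)
  \<comment> \<open>An equivalence relation on the carrier relates only its members, so the
    memberships of \<open>a\<close> and \<open>b\<close> demanded by the definition come for
    free.\<close>
  then have "S \<subseteq> bwords X \<times> bwords X"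
    by (rule equiv_type)
  with assms show "(a, b) \<in> S \<Longrightarrow> c \<in> bwords X \<Longrightarrow> (a @ c, b @ c) \<in> S"
    and "(a, b) \<in> S \<Longrightarrow> c \<in> bwords X \<Longrightarrow> (c @ a, c @ b) \<in> S"
    and "(a, b) \<in> S \<Longrightarrow> (bracket a, bracket b) \<in> S"
    and "(a, b) \<in> S \<Longrightarrow> a \<in> bwords X \<and> b \<in> bwords X"
    unfolding operated_congruence_def by blast+
qed

text \<open>One factor is changed at a time, passing through \<open>b @ c\<close>; transitivity
  joins the two steps.\<close>

lemma operated_congruence_append:
  assumes S: "operated_congruence X S" and "(a, b) \<in> S" "(c, d) \<in> S"
  shows "(a @ c, b @ d) \<in> S"
proof -
  have "b \<in> bwords X" "c \<in> bwords X"
    using assms operated_congruenceD(5)[OF S] by simp_all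
  then have "(a @ c, b @ c) \<in> S" "(b @ c, b @ d) \<in> S"
    using assms operated_congruenceD(2,3)[OF S] by simp_all
  moreover have "trans S"
    using operated_congruenceD(1)[OF S] by (simp add: equiv_def)
  ultimately show ?thesis
    by (meson transD)
qed

lemma operated_congruence_star_subst:
  assumes S: "operated_congruence X S" and ab: "(a, b) \<in> S"
    and "q \<in> bwords (insert None (Some ` X))"
  shows "(star_subst q a, star_subst q b) \<in> S"
proof -
  have refl: "(w, w) \<in> S" if "w \<in> bwords X" for w
    using operated_congruenceD(1)[OF S] that by (simp add: equiv_def refl_on_def)
  show ?thesis
    using assms(3)
  proof (induction rule: bwords_induct)
    case Nil
    show ?case
      by (simp add: star_subst_simps refl Nil_in_bwords)
  next
    case (Gen x w)
    show ?case
    \<comment> \<open>At a star the heads become \<open>a\<close> and \<open>b\<close>, related by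
      assumption; at an ordinary generator they coincide, and reflexivity relates them. The tails
      are related by induction.\<close>
    proof (cases x)
      case None
      with Gen ab show ?thesis
        by (simp add: star_subst_simps operated_congruence_append[OF S])
    next
      case (Some y)
      with Gen have "([Gen y], [Gen y]) \<in> S"
        by (auto intro: refl Gen_in_bwords)
      from operated_congruence_append[OF S this Gen.IH] Some show ?thesis
        by (simp add: star_subst_simps)
    qed
  next
    case (Bracket u w)
    then show ?case
      by (simp add: star_subst_simps operated_congruence_append[OF S] operated_congruenceD(4)[OF S])
  qed
qed

lemma equiv_gen_map:
  assumes T: "T \<subseteq> A \<times> A" and f: "\<And>a. a \<in> A \<Longrightarrow> f a \<in> A"
    and Tf: "\<And>a b. (a, b) \<in> T \<Longrightarrow> (f a, f b) \<in> T"
    and ab: "(a, b) \<in> equiv_gen A T"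
  shows "(f a, f b) \<in> equiv_gen A T"
proof -
  \<comment> \<open>The pullback of the generated equivalence along \<open>f\<close> is itself an
    equivalence on \<open>A\<close> and contains \<open>T\<close>, so minimality applies to
    it.\<close>
  define E where "E = {(a, b) \<in> A \<times> A. (f a, f b) \<in> equiv_gen A T}"
  note least = equiv_gen_least[OF T]
  have "equiv A E"
    using least(1) f unfolding equiv_def refl_on_def sym_def trans_def E_def by blast
  moreover have "T \<subseteq> E"
    using T Tf least(2) unfolding E_def by blast
  ultimately have "equiv_gen A T \<subseteq> E"
    by (rule least(3))
  with ab show ?thesis
    unfolding E_def by blast
qed

lemma subset_star_closure: "R \<subseteq> star_closure X R"
proof -
  \<comment> \<open>The trivial context, a star alone, reproduces each pair of
    \<open>R\<close>.\<close>
  have "[Gen None] \<in> star_bwords X"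
    by (auto simp: star_bwords_def star_count_simps intro: Gen_in_bwords)
  moreover have "star_subst [Gen None] u = u" for u :: "'a bword"
    by (simp add: star_subst_simps)
  ultimately have "(a, b) \<in> star_closure X R" if "(a, b) \<in> R" for a b
    using that unfolding star_closure_def mem_Collect_eq
    by (intro exI[of _ "[Gen None]"] exI[of _ a] exI[of _ b]) simp
  then show ?thesis
    by auto
qed

text \<open>Each operation is carried out on the context instead of on the two words: bracketing or
  multiplying q|_u is the same as substituting \<open>u\<close> into a bracketed or multiplied
  context.\<close>

lemma star_closure_compatible:
  assumes "(a, b) \<in> star_closure X R"
  shows "c \<in> bwords X \<Longrightarrow> (a @ c, b @ c) \<in> star_closure X R"
    and "c \<in> bwords X \<Longrightarrow> (c @ a, c @ b) \<in> star_closure X R"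
    and "(bracket a, bracket b) \<in> star_closure X R"
proof -
  obtain q u v where q: "q \<in> star_bwords X" and uv: "(u, v) \<in> R"
    and ab: "a = star_subst q u" "b = star_subst q v"
    using assms unfolding star_closure_def by blast
  have closureI: "(star_subst p u, star_subst p v) \<in> star_closure X R" if "p \<in> star_bwords X" for p
    using that uv unfolding star_closure_def by blast
  have "bracket q \<in> star_bwords X"
    using q by (auto simp: star_bwords_def bracket_in_bwords)
      (simp add: bracket_def star_count_simps)
  from closureI[OF this] show "(bracket a, bracket b) \<in> star_closure X R"
    by (simp add: ab bracket_def star_subst_simps)
  assume "c \<in> bwords X"
  then obtain p where p: "p \<in> bwords (insert None (Some ` X))" "star_count p = 0"
    "\<And>u. star_subst p u = c"
    using star_free_bword by blast
  \<comment> \<open>Since \<open>p\<close> has no star, the one star of \<open>q\<close> remains the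
    only one.\<close>
  then have "q @ p \<in> star_bwords X" "p @ q \<in> star_bwords X"
    using q by (auto simp: star_bwords_def star_count_simps intro: append_in_bwords)
  from this[THEN closureI] p(3) show "(a @ c, b @ c) \<in> star_closure X R"
    and "(c @ a, c @ b) \<in> star_closure X R"
    by (simp_all add: ab star_subst_simps)
qed

theorem proposition2p10:
  fixes X :: "'a set" and R :: "'a bword rel"
  assumes "R \<subseteq> bwords X \<times> bwords X"
  shows "op_cong_gen X R = equiv_gen (bwords X) (star_closure X R)"
proof
  note T = star_closure_subset[OF assms]
  note cong = op_cong_gen_least[OF assms]
  let ?E = "equiv_gen (bwords X) (star_closure X R)"
  have "operated_congruence X ?E"
    unfolding operated_congruence_def
  proof (intro conjI ballI impI)
    show "equiv (bwords X) ?E"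
      using T by (rule equiv_gen_least(1))
    fix a b c
    assume c: "c \<in> bwords X" and ab: "(a, b) \<in> ?E"
    \<comment> \<open>Each of the three operations is a self-map of the carrier that preserves the
      context closure, hence also the equivalence relation it generates.\<close>
    show "(a @ c, b @ c) \<in> ?E"
      by (rule equiv_gen_map[where f = "\<lambda>w. w @ c", OF T _ _ ab])
        (use c in \<open>auto intro: append_in_bwords star_closure_compatible\<close>)
    show "(c @ a, c @ b) \<in> ?E"
      by (rule equiv_gen_map[where f = "\<lambda>w. c @ w", OF T _ _ ab])
        (use c in \<open>auto intro: append_in_bwords star_closure_compatible\<close>)
    show "(bracket a, bracket b) \<in> ?E"
      by (rule equiv_gen_map[where f = bracket, OF T _ _ ab])
        (auto intro: bracket_in_bwords star_closure_compatible)
  qed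
  moreover have "R \<subseteq> ?E"
    using subset_star_closure equiv_gen_least(2)[OF T] by (rule subset_trans)
  ultimately show "op_cong_gen X R \<subseteq> ?E"
    by (rule cong(3))
  \<comment> \<open>The generated congruence contains \<open>R\<close>, so it relates the two
    substitution instances of every context; being an equivalence relation, it then contains
    \<open>?E\<close>.\<close>
  have "star_closure X R \<subseteq> op_cong_gen X R"
    using operated_congruence_star_subst[OF cong(1)] cong(2)
    unfolding star_closure_def star_bwords_def by blast
  then show "?E \<subseteq> op_cong_gen X R"
    by (rule equiv_gen_least(3)[OF T operated_congruenceD(1)[OF cong(1)]])
qed

end
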